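(* For every real $\alpha$ with $0<\alpha<1/2$ there exists a positive constant $c_\alpha$ such that for every positive integer $N$ there exists a set $\mathcal{M}$ of positive integers of cardinality $N$ with \[ \sum_{m,n\in\mathcal{M}}\frac{(m,n)^{2\alpha}}{(mn)^{\alpha}}\ge c_\alpha N^{2-2\alpha}(\log N)^{2\alpha}. \]
   Context: $(m,n)$ denotes the greatest common divisor of $m$ and $n$. *)

theory Defs
  imports Complex_Main
begin

end

theory Submission
  imports Defs "HOL-Analysis.Harmonic_Numbers"
begin

text \<open>
  Take the \<open>m\<close> to be multiples \<open>K a / b\<close> of reduced fractions with \<open>a b \<le> T\<close>, where \<open>K = T!\<close>. For two
  of them, \<open>gcd m n\<^sup>2 / (m n) \<ge> 1 / (a b c d) \<ge> 1 / T\<^sup>2\<close>, so each of the \<open>N\<^sup>2\<close> terms of the sum is at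
  least \<open>T\<close> to the power \<open>- 2 \<alpha>\<close>. There are at least \<open>T log T / 8\<close> such fractions once \<open>log T \<ge> 8\<close>,
  hence \<open>N\<close> of them can be found with \<open>T\<close> of order \<open>N / log N\<close>.
\<close>

section \<open>Counting lattice points under the hyperbola \<open>a * b = T\<close>\<close>

definition hyperbola_pairs :: "nat \<Rightarrow> (nat \<times> nat) set" where
  "hyperbola_pairs T = {(a, b). 0 < a \<and> 0 < b \<and> a * b \<le> T}"

definition coprime_hyperbola_pairs :: "nat \<Rightarrow> (nat \<times> nat) set" where
  "coprime_hyperbola_pairs T = {(a, b) \<in> hyperbola_pairs T. coprime a b}"

text \<open>Columns with \<open>a > T\<close> are empty, so the outer range may be longer than
  \<open>T\<close>. This slack later lets the counts for all \<open>T div g\<^sup>2\<close> be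
  bounded by means of the same harmonic number \<open>harm T\<close>.\<close>

lemma hyperbola_pairs_eq_Sigma:
  assumes "T \<le> S"
  shows "hyperbola_pairs T = (SIGMA a:{1..S}. {1..T div a})"
proof -
  have "a \<le> S" if "a * b \<le> T" "0 < b" for a b
  proof -
    have "a * 1 \<le> a * b" using that by (intro mult_le_mono) auto
    with that assms show ?thesis by linarith
  qed
  then have "(a, b) \<in> hyperbola_pairs T \<longleftrightarrow> a \<in> {1..S} \<and> b \<in> {1..T div a}" for a b
    by (cases "a = 0")
       (auto simp: hyperbola_pairs_def less_eq_div_iff_mult_less_eq mult.commute[of b a] Suc_le_eq)
  then show ?thesis by auto
qed

lemma finite_hyperbola_pairs: "finite (hyperbola_pairs T)"
  by (simp add: hyperbola_pairs_eq_Sigma[OF order_refl])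

lemma card_hyperbola_pairs:
  assumes "T \<le> S"
  shows "card (hyperbola_pairs T) = (\<Sum>a=1..S. T div a)"
  by (simp add: hyperbola_pairs_eq_Sigma[OF assms])

lemma card_hyperbola_pairs_le:
  assumes "T \<le> S"
  shows "real (card (hyperbola_pairs T)) \<le> real T * harm S"
proof -
  have "real (card (hyperbola_pairs T)) = (\<Sum>a=1..S. real (T div a))"
    by (simp add: card_hyperbola_pairs[OF assms])
  also have "\<dots> \<le> (\<Sum>a=1..S. real T * inverse (real a))"
    by (intro sum_mono) (simp add: of_nat_div_le_of_nat flip: divide_inverse)
  finally show ?thesis
    by (simp add: harm_def sum_distrib_left)
qed

text \<open>Rounding down costs at most 1 in each of the \<open>T\<close> columns.\<close>

lemma card_hyperbola_pairs_ge:
  "real (card (hyperbola_pairs T)) \<ge> real T * harm T - real T"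
proof -
  have "real T * harm T - real T = (\<Sum>a=1..T. real T / real a - 1)"
    by (simp add: harm_def sum_distrib_left sum_subtractf divide_inverse)
  also have "\<dots> \<le> (\<Sum>a=1..T. real (T div a))"
  proof (intro sum_mono)
    fix a
    show "real T / real a - 1 \<le> real (T div a)"
      using floor_divide_of_nat_eq[of T a, where ?'a = real] by linarith
  qed
  finally show ?thesis
    by (simp add: card_hyperbola_pairs[OF order_refl])
qed

section \<open>Discarding the pairs with a common factor\<close>

lemma sum_inverse_squares_from_2_le:
  "(\<Sum>g=2..n. 1 / (real g)\<^sup>2) \<le> 3 / 4"
proof -
  \<comment> \<open>The term \<open>- 1 / n\<close> makes the induction telescope;
    \<open>3 / 4\<close> is fixed by equality at \<open>n = 2\<close>. All that matters later is
    that it is below 1.\<close>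
  have "(\<Sum>g=2..n. 1 / (real g)\<^sup>2) \<le> 3 / 4 - 1 / real n" if "n \<ge> 2"
    using that
  proof (induction n rule: dec_induct)
    case base
    then show ?case by simp
  next
    case (step n)
    have "1 / (real (Suc n))\<^sup>2 \<le> 1 / real n - 1 / real (Suc n)"
      using step.hyps by (simp add: divide_simps power2_eq_square)
    with step show ?case by simp
  qed
  moreover have "0 \<le> 1 / real n" by simp
  ultimately show ?thesis
    by (cases "n \<ge> 2") (linarith, simp)
qed

text \<open>Dividing a pair by its gcd \<open>g\<close> divides the product by
  \<open>g\<^sup>2\<close>. The images may overlap, which is harmless since only an upper bound for
  the number of non-coprime pairs is wanted.\<close>

lemma hyperbola_pairs_subset:
  "hyperbola_pairs T \<subseteq> coprime_hyperbola_pairs T \<union>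
     (\<Union>g\<in>{2..T}. map_prod ((*) g) ((*) g) ` hyperbola_pairs (T div g\<^sup>2))"
proof (rule subrelI)
  fix a b assume ab: "(a, b) \<in> hyperbola_pairs T"
  then have pos: "0 < a" "0 < b" and le: "a * b \<le> T" by (auto simp: hyperbola_pairs_def)
  show "(a, b) \<in> coprime_hyperbola_pairs T \<union>
     (\<Union>g\<in>{2..T}. map_prod ((*) g) ((*) g) ` hyperbola_pairs (T div g\<^sup>2))"
  proof (cases "coprime a b")
    case True
    with ab show ?thesis by (simp add: coprime_hyperbola_pairs_def)
  next
    case False
    define g where "g = gcd a b"
    obtain c d where cd: "a = g * c" "b = g * d"
      unfolding g_def by (meson dvdE gcd_dvd1 gcd_dvd2)
    have "g \<noteq> 1" "g \<noteq> 0" using False pos by (auto simp: g_def coprime_iff_gcd_eq_1)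
    then have g: "2 \<le> g" by simp
    have "g \<le> a" using pos by (simp add: g_def)
    also have "a \<le> a * b" using pos by simp
    finally have "g \<in> {2..T}" using g le by simp
    moreover have "(c, d) \<in> hyperbola_pairs (T div g\<^sup>2)"
      using pos le g
      by (auto simp: cd hyperbola_pairs_def less_eq_div_iff_mult_less_eq power2_eq_square ac_simps)
    ultimately show ?thesis by (force simp: cd)
  qed
qed

text \<open>There are at least \<open>T * harm T - T\<close> pairs in all, and the union bound over
  \<open>g\<close> removes at most \<open>3 / 4\<close> of the main term
  \<open>T * harm T\<close>.\<close>

lemma card_coprime_hyperbola_pairs_ge:
  "real (card (coprime_hyperbola_pairs T)) \<ge> real T * (harm T / 4 - 1)"
proof -
  let ?C = "coprime_hyperbola_pairs T"
  let ?D = "\<lambda>g. map_prod ((*) g) ((*) g) ` hyperbola_pairs (T div g\<^sup>2)"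
  have finC: "finite ?C"
    by (rule finite_subset[OF _ finite_hyperbola_pairs[of T]])
       (auto simp: coprime_hyperbola_pairs_def)
  have "card (hyperbola_pairs T) \<le> card (?C \<union> (\<Union>g\<in>{2..T}. ?D g))"
    by (intro card_mono hyperbola_pairs_subset) (auto simp: finC finite_hyperbola_pairs)
  also have "\<dots> \<le> card ?C + card (\<Union>g\<in>{2..T}. ?D g)"
    by (rule card_Un_le)
  also have "\<dots> \<le> card ?C + (\<Sum>g=2..T. card (?D g))"
    by (intro add_left_mono card_UN_le) simp
  also have "\<dots> \<le> card ?C + (\<Sum>g=2..T. card (hyperbola_pairs (T div g\<^sup>2)))"
    by (intro add_left_mono sum_mono card_image_le finite_hyperbola_pairs)
  finally have "real (card (hyperbola_pairs T)) \<le>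
      real (card ?C) + (\<Sum>g=2..T. real (card (hyperbola_pairs (T div g\<^sup>2))))"
    by (simp flip: of_nat_sum of_nat_add)
  also have "(\<Sum>g=2..T. real (card (hyperbola_pairs (T div g\<^sup>2)))) \<le>
      (\<Sum>g=2..T. (real T * harm T) * (1 / (real g)\<^sup>2))"
  proof (intro sum_mono)
    fix g
    have "real (card (hyperbola_pairs (T div g\<^sup>2))) \<le> real (T div g\<^sup>2) * harm T"
      by (rule card_hyperbola_pairs_le) simp
    also have "\<dots> \<le> (real T / (real g)\<^sup>2) * harm T"
      using of_nat_div_le_of_nat[of T "g\<^sup>2", where ?'a = real] by (intro mult_right_mono harm_nonneg) simp
    finally show "real (card (hyperbola_pairs (T div g\<^sup>2))) \<le> (real T * harm T) * (1 / (real g)\<^sup>2)"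
      by simp
  qed
  also have "\<dots> = real T * harm T * (\<Sum>g=2..T. 1 / (real g)\<^sup>2)"
    by (rule sum_distrib_left[symmetric])
  also have "\<dots> \<le> real T * harm T * (3 / 4)"
    by (intro mult_left_mono sum_inverse_squares_from_2_le mult_nonneg_nonneg harm_nonneg) simp
  finally show ?thesis
    using card_hyperbola_pairs_ge[of T] by (simp add: algebra_simps)
qed

text \<open>For \<open>L = ln T\<close>, the inequality \<open>L / 4 - 1 \<ge> L / 8\<close> holds
  exactly from \<open>L = 8\<close> on.\<close>

lemma card_coprime_hyperbola_pairs_ge_ln:
  assumes "8 \<le> ln (real T)"
  shows "real (card (coprime_hyperbola_pairs T)) \<ge> real T * ln (real T) / 8"
proof -
  have "T > 0" using assms by (cases T) auto
  then have "ln (real T) \<le> ln (real T + 1)" by simp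
  also have "\<dots> \<le> harm T" by (rule ln_le_harm)
  finally have "ln (real T) / 8 \<le> harm T / 4 - 1" using assms by linarith
  then have "real T * (ln (real T) / 8) \<le> real T * (harm T / 4 - 1)"
    by (intro mult_left_mono) auto
  with card_coprime_hyperbola_pairs_ge[of T] show ?thesis by simp
qed

section \<open>From fractions to integers with large gcds\<close>

text \<open>Here \<open>m / n = (a * d) / (b * c)\<close>. In lowest terms its numerator divides
  \<open>a * d\<close> and its denominator divides \<open>b * c\<close>, and the product of the two
  is \<open>m * n\<close> divided by the square of the gcd.\<close>

lemma mult_le_gcd_square_mult:
  fixes m n a b c d K :: nat
  assumes pos: "0 < a" "0 < b" "0 < c" "0 < d" "0 < m" "0 < n"
    and mb: "m * b = K * a" and nd: "n * d = K * c"
  shows "m * n \<le> (gcd m n)\<^sup>2 * (a * b * (c * d))"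
proof -
  define g where "g = gcd m n"
  have g: "g > 0" using pos by (simp add: g_def)
  obtain m' n' where m': "m = g * m'" "n = g * n'" "coprime m' n'"
    using gcd_coprime_exists[of m n] g unfolding g_def by (metis mult.commute less_irrefl)
  have "g * (m' * (b * c)) = (m * b) * c" by (simp add: m')
  also have "\<dots> = (n * d) * a" by (simp add: mb nd)
  also have "\<dots> = g * (n' * (a * d))" by (simp add: m')
  finally have eq: "m' * (b * c) = n' * (a * d)" using g by simp
  have "m' dvd a * d"
    using eq m'(3) by (metis coprime_dvd_mult_right_iff dvd_triv_left)
  then have 1: "m' \<le> a * d" using pos by (intro dvd_imp_le) auto
  have "n' dvd b * c"
    using eq m'(3) by (metis coprime_commute coprime_dvd_mult_right_iff dvd_triv_left)
  then have 2: "n' \<le> b * c" using pos by (intro dvd_imp_le) auto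
  have "m' * n' \<le> (a * d) * (b * c)" by (rule mult_le_mono[OF 1 2])
  then have "g\<^sup>2 * (m' * n') \<le> g\<^sup>2 * (a * b * (c * d))"
    by (intro mult_le_mono2) (simp add: ac_simps)
  moreover have "m * n = g\<^sup>2 * (m' * n')" by (simp add: m' power2_eq_square)
  ultimately show ?thesis by (simp add: g_def)
qed

lemma gcd_powr_ge:
  fixes m n T :: nat and \<alpha> :: real
  assumes "0 < m" "0 < n" "0 \<le> \<alpha>" "0 < T" and le: "m * n \<le> (gcd m n)\<^sup>2 * T\<^sup>2"
  shows "real T powr (- 2 * \<alpha>) \<le> real (gcd m n) powr (2 * \<alpha>) / real (m * n) powr \<alpha>"
proof -
  have "real (m * n) \<le> (real (gcd m n) * real T)\<^sup>2"
    using le by (metis of_nat_le_iff of_nat_mult of_nat_power power_mult_distrib)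
  also have "\<dots> = (real (gcd m n) * real T) powr 2"
    using assms by simp
  finally have "real (m * n) powr \<alpha> \<le> ((real (gcd m n) * real T) powr 2) powr \<alpha>"
    using assms by (intro powr_mono2) auto
  also have "\<dots> = real (gcd m n) powr (2 * \<alpha>) * real T powr (2 * \<alpha>)"
    by (simp only: powr_powr) (simp add: powr_mult)
  finally show ?thesis
    using assms by (simp add: powr_minus field_simps)
qed

lemma exists_set_gcd_sum_ge:
  assumes P: "P \<subseteq> coprime_hyperbola_pairs T" and fin: "finite P" and T: "0 < T"
    and \<alpha>: "0 \<le> (\<alpha> :: real)"
  obtains M :: "nat set" where "finite M" "card M = card P" "\<forall>m\<in>M. 0 < m"
    "(real (card P))\<^sup>2 * real T powr (- 2 * \<alpha>) \<le>
       (\<Sum>m\<in>M. \<Sum>n\<in>M. real (gcd m n) powr (2 * \<alpha>) / real (m * n) powr \<alpha>)"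
proof -
  define K :: nat where "K = fact T"
  \<comment> \<open>The division is exact on \<open>P\<close>: each denominator satisfies
    \<open>b \<le> a * b \<le> T\<close>, hence divides \<open>fact T\<close>.\<close>
  define f where "f = (\<lambda>(a, b). K * a div b)"
  have K: "K > 0" by (simp add: K_def)
  have P': "0 < a" "0 < b" "a * b \<le> T" "coprime a b" "f (a, b) * b = K * a" "0 < f (a, b)"
    if "(a, b) \<in> P" for a b
  proof -
    show ab: "0 < a" "0 < b" "a * b \<le> T" "coprime a b"
      using that P by (auto simp: coprime_hyperbola_pairs_def hyperbola_pairs_def)
    have "b \<le> a * b" using ab by simp
    also note ab(3)
    finally have "b dvd K" unfolding K_def using ab by (intro dvd_fact) auto
    then show eq: "f (a, b) * b = K * a" by (simp add: f_def)
    show "0 < f (a, b)" using eq K ab by (metis gr0I mult_eq_0_iff)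
  qed
  \<comment> \<open>Equal values mean equal fractions \<open>a / b = c / d\<close>, and reduced
    fractions determine their pairs.\<close>
  have inj: "inj_on f P"
  proof (rule inj_onI, clarify)
    fix a b c d assume ab: "(a, b) \<in> P" and cd: "(c, d) \<in> P" and eq: "f (a, b) = f (c, d)"
    have "K * (a * d) = f (a, b) * b * d" using P'(5)[OF ab] by simp
    also have "\<dots> = f (c, d) * d * b" by (simp add: eq)
    also have "\<dots> = K * (c * b)" using P'(5)[OF cd] by simp
    finally have "a * d = c * b" using K by simp
    then show "a = c \<and> b = d"
      using coprime_crossproduct_nat[of a b c d] P'(4)[OF ab] P'(4)[OF cd]
      by (simp add: coprime_commute ac_simps)
  qed
  let ?t = "\<lambda>m n. real (gcd m n) powr (2 * \<alpha>) / real (m * n) powr \<alpha>"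
  have summand: "real T powr (- 2 * \<alpha>) \<le> ?t m n" if m: "m \<in> f ` P" and n: "n \<in> f ` P" for m n
  proof -
    from m obtain a b where ab: "(a, b) \<in> P" "m = f (a, b)" by auto
    from n obtain c d where cd: "(c, d) \<in> P" "n = f (c, d)" by auto
    have "m * n \<le> (gcd m n)\<^sup>2 * (a * b * (c * d))"
      using P'[OF ab(1)] P'[OF cd(1)] unfolding ab(2) cd(2) by (intro mult_le_gcd_square_mult)
    also have "\<dots> \<le> (gcd m n)\<^sup>2 * T\<^sup>2"
      unfolding power2_eq_square[of T] using P'(3)[OF ab(1)] P'(3)[OF cd(1)]
      by (intro mult_le_mono) auto
    finally show ?thesis
      using P'(6)[OF ab(1)] P'(6)[OF cd(1)] \<alpha> T by (intro gcd_powr_ge) (auto simp: ab cd)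
  qed
  have "(\<Sum>m\<in>f ` P. \<Sum>n\<in>f ` P. real T powr (- 2 * \<alpha>)) \<le> (\<Sum>m\<in>f ` P. \<Sum>n\<in>f ` P. ?t m n)"
    by (intro sum_mono summand)
  then have sum: "(real (card P))\<^sup>2 * real T powr (- 2 * \<alpha>) \<le> (\<Sum>m\<in>f ` P. \<Sum>n\<in>f ` P. ?t m n)"
    by (simp add: card_image[OF inj] power2_eq_square mult.assoc)
  have pos: "\<forall>m\<in>f ` P. 0 < m" using P'(6) by auto
  show ?thesis
    by (rule that[OF _ card_image[OF inj] pos sum]) (simp add: fin)
qed

section \<open>Choosing \<open>T\<close> in terms of \<open>N\<close>\<close>

lemma exists_coprime_hyperbola_pairs_card_ge:
  assumes N: "N \<ge> (2 :: nat)"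
  obtains T :: nat where "0 < T" "real T \<le> 2 * exp 8 * real N / ln (real N)"
    "N \<le> card (coprime_hyperbola_pairs T)"
proof -
  \<comment> \<open>The factor \<open>exp 8\<close> serves twice: it forces
    \<open>ln T \<ge> 8\<close> even for small \<open>N\<close>, and it outweighs the constant 16
    lost in the count.\<close>
  define x where "x = exp 8 * real N / ln (real N)"
  define T where "T = nat \<lceil>x\<rceil>"
  have lnN: "ln (real N) > 0" using N by simp
  have lnN_le: "ln (real N) \<le> real N"
    using ln_le_minus_one[of "real N"] N by simp
  have x8: "exp 8 \<le> x"
    using lnN lnN_le by (simp add: x_def field_simps)
  have Tx: "x \<le> real T" "real T \<le> x + 1"
    unfolding T_def using x8 exp_gt_zero[of "8::real"] by linarith+
  have e9: "(9::real) \<le> exp 8" using exp_ge_add_one_self[of "8::real"] by simp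
  have Tpos: "0 < T" using Tx x8 e9 by (cases T) auto
  have lnT8: "8 \<le> ln (real T)"
    using x8 Tx Tpos by (subst ln_ge_iff) auto
  \<comment> \<open>Since \<open>ln N\<close> is at most \<open>exp 8 * sqrt N\<close>, it follows
    that \<open>sqrt N \<le> x \<le> T\<close>, so passing from \<open>ln N\<close> to
    \<open>ln T\<close> loses at most a factor 2.\<close>
  have "ln (real N) = 2 * ln (sqrt (real N))" using N by (simp add: ln_sqrt)
  also have "\<dots> \<le> 2 * sqrt (real N)" using ln_le_minus_one[of "sqrt (real N)"] N by simp
  also have "\<dots> \<le> exp 8 * sqrt (real N)" using e9 by (intro mult_right_mono) auto
  finally have "sqrt (real N) * ln (real N) \<le> sqrt (real N) * (exp 8 * sqrt (real N))"
    by (intro mult_left_mono) auto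
  also have "\<dots> = exp 8 * real N" by simp
  finally have "sqrt (real N) \<le> x" using lnN by (simp add: x_def field_simps)
  then have "ln (sqrt (real N)) \<le> ln (real T)" using Tx N by (intro ln_mono) auto
  then have lnT: "ln (real N) / 2 \<le> ln (real T)" using N by (simp add: ln_sqrt)
  \<comment> \<open>16 is the 8 of the counting bound times the 2 from
    \<open>ln T \<ge> ln N / 2\<close>.\<close>
  have e16: "(16::real) \<le> exp 8"
  proof -
    have "(5::real) * 5 \<le> exp 4 * exp 4"
      using exp_ge_add_one_self[of "4::real"] by (intro mult_mono) auto
    also have "\<dots> = exp 8" by (simp flip: exp_add)
    finally show ?thesis by simp
  qed
  have "real N \<le> exp 8 * real N / 16"
    using mult_right_mono[OF e16, of "real N"] by simp
  also have "\<dots> = x * (ln (real N) / 2) / 8" using lnN by (simp add: x_def)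
  also have "\<dots> \<le> real T * ln (real T) / 8"
    using Tx lnT lnN x8 e9 by (intro divide_right_mono mult_mono) auto
  also have "\<dots> \<le> real (card (coprime_hyperbola_pairs T))"
    by (rule card_coprime_hyperbola_pairs_ge_ln[OF lnT8])
  finally have "N \<le> card (coprime_hyperbola_pairs T)" by simp
  \<comment> \<open>The factor 2 absorbs the rounding up, as \<open>x \<ge> 1\<close>.\<close>
  moreover have "real T \<le> 2 * exp 8 * real N / ln (real N)"
    using Tx x8 e9 by (simp add: x_def)
  ultimately show ?thesis using that Tpos by blast
qed

theorem theorem8:
  shows "\<forall>\<alpha>::real. 0 < \<alpha> \<and> \<alpha> < 1/2 \<longrightarrow>
    (\<exists>c::real. c > 0 \<and>
      (\<forall>N::nat. N \<ge> 1 \<longrightarrow>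
        (\<exists>M::nat set. finite M \<and> card M = N \<and> (\<forall>m\<in>M. m > 0) \<and>
          (\<Sum>m\<in>M. \<Sum>n\<in>M. real (gcd m n) powr (2*\<alpha>) / (real (m*n)) powr \<alpha>)
            \<ge> c * real N powr (2 - 2*\<alpha>) * (ln (real N)) powr (2*\<alpha>))))"
proof (intro allI impI, elim conjE)
  fix \<alpha> :: real assume \<alpha>: "0 < \<alpha>" "\<alpha> < 1/2"
  \<comment> \<open>This is the constant left over when the bound
    \<open>2 * exp 8 * N / ln N\<close> for \<open>T\<close> is put into
    \<open>N\<^sup>2 * T powr (- 2 * \<alpha>)\<close>.\<close>
  define c :: real where "c = (2 * exp 8) powr (- 2 * \<alpha>)"
  have "\<exists>M::nat set. finite M \<and> card M = N \<and> (\<forall>m\<in>M. m > 0) \<and>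
          (\<Sum>m\<in>M. \<Sum>n\<in>M. real (gcd m n) powr (2*\<alpha>) / (real (m*n)) powr \<alpha>)
            \<ge> c * real N powr (2 - 2*\<alpha>) * (ln (real N)) powr (2*\<alpha>)" if "N \<ge> 1" for N :: nat
  proof (cases "N = 1")
    case True
    \<comment> \<open>The right-hand side vanishes, since \<open>ln 1 = 0\<close> and
      \<open>0 powr (2 * \<alpha>) = 0\<close>.\<close>
    then show ?thesis by (intro exI[of _ "{1}"]) simp
  next
    case False
    with \<open>N \<ge> 1\<close> have N: "N \<ge> 2" by simp
    then have lnN: "ln (real N) > 0" by simp
    obtain T where T: "0 < T" "real T \<le> 2 * exp 8 * real N / ln (real N)"
      "N \<le> card (coprime_hyperbola_pairs T)"
      using exists_coprime_hyperbola_pairs_card_ge[OF N] by blast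
    \<comment> \<open>The count gives at least \<open>N\<close> pairs; the cardinality has to be
      exactly \<open>N\<close>.\<close>
    obtain P where P: "P \<subseteq> coprime_hyperbola_pairs T" "card P = N" "finite P"
      using obtain_subset_with_card_n[OF T(3)] by blast
    obtain M :: "nat set" where M: "finite M" "card M = N" "\<forall>m\<in>M. 0 < m"
      "(real N)\<^sup>2 * real T powr (- 2 * \<alpha>) \<le>
         (\<Sum>m\<in>M. \<Sum>n\<in>M. real (gcd m n) powr (2 * \<alpha>) / real (m * n) powr \<alpha>)"
      using exists_set_gcd_sum_ge[OF P(1,3) T(1), of \<alpha>] \<alpha> P(2) by auto
    have "(real N)\<^sup>2 = real N powr 2" using N by simp
    then have "c * real N powr (2 - 2 * \<alpha>) * ln (real N) powr (2 * \<alpha>)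
        = (real N)\<^sup>2 * (2 * exp 8 * real N / ln (real N)) powr (- 2 * \<alpha>)"
      using N lnN by (simp add: c_def powr_divide powr_mult powr_minus powr_diff field_simps)
    \<comment> \<open>The exponent is negative, so the upper bound on \<open>T\<close> bounds the
      power from below.\<close>
    also have "\<dots> \<le> (real N)\<^sup>2 * real T powr (- 2 * \<alpha>)"
      using T \<alpha> by (intro mult_left_mono powr_mono2') auto
    also note M(4)
    finally show ?thesis using M by blast
  qed
  moreover have "c > 0" by (simp add: c_def)
  ultimately show "\<exists>c::real. c > 0 \<and>
      (\<forall>N::nat. N \<ge> 1 \<longrightarrow>
        (\<exists>M::nat set. finite M \<and> card M = N \<and> (\<forall>m\<in>M. m > 0) \<and>
          (\<Sum>m\<in>M. \<Sum>n\<in>M. real (gcd m n) powr (2*\<alpha>) / (real (m*n)) powr \<alpha>)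
            \<ge> c * real N powr (2 - 2*\<alpha>) * (ln (real N)) powr (2*\<alpha>)))"
    by blast
qed

end
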